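(* Let $n\in\mathbb{N}$, let $\psi_j:\mathbb{R}\to\mathbb{R}$, $j\in\mathbb{N}_n$, be convex functions, and suppose that the function $\bm{\psi}:\mathbb{R}^n\to[0,+\infty)$ has the form $\bm{\psi}(\mathbf{u})=\sum_{j\in\mathbb{N}_n}\psi_j(u_j)$ for all $\mathbf{u}=[u_j:j\in\mathbb{N}_n]\in\mathbb{R}^n$. Let $\lambda>0$ and $l\in\{0,1,\ldots,n\}$. Then the regularization problem $$\min\{\bm{\psi}(\mathbf{u})+\lambda\|\mathbf{u}\|_1:\mathbf{u}\in\mathbb{R}^n\}$$ has a solution having sparsity of level $l'$ for some $l'\leq l$ if and only if there exist distinct $k_i\in\mathbb{N}_n$, $i\in\mathbb{N}_l$, such that $$\lambda\geq\max\{\psi'_{j,-}(0),-\psi'_{j,+}(0)\}\quad\text{for all } j\in\mathbb{N}_n\setminus\{k_i:i\in\mathbb{N}_l\}.\qquad ( * )$$ In particular, if all $\psi_j$, $j\in\mathbb{N}_n$, are differentiable, then condition $( * )$ is equivalent to $$\lambda\geq|\psi_j'(0)|\quad\text{for all } j\in\mathbb{N}_n\setminus\{k_i:i\in\mathbb{N}_l\}.$$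
   Context: $\mathbb{N}_d:=\{1,\ldots,d\}$ and $\mathbb{N}_0:=\emptyset$. $\|\mathbf{u}\|_1=\sum_j|u_j|$. A solution of a minimization problem is a point at which the minimum is attained. A vector in $\mathbb{R}^n$ has sparsity of level $l$ if it has exactly $l$ nonzero components. $\psi'_{j,-}$ and $\psi'_{j,+}$ denote the left and right derivatives of the convex function $\psi_j$. *)

theory Defs
  imports "HOL-Analysis.Analysis"
begin

definition left_deriv :: "(real \<Rightarrow> real) \<Rightarrow> real \<Rightarrow> real" where
  "left_deriv f x = Lim (at_left x) (\<lambda>t. (f t - f x) / (t - x))"

definition right_deriv :: "(real \<Rightarrow> real) \<Rightarrow> real \<Rightarrow> real" where
  "right_deriv f x = Lim (at_right x) (\<lambda>t. (f t - f x) / (t - x))"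

(* The norm that the library puts on real ^ 'n is the Euclidean one. *)
definition l1_norm :: "real ^ 'n \<Rightarrow> real" where
  "l1_norm u = (\<Sum>j\<in>UNIV. \<bar>u $ j\<bar>)"

definition has_sparsity_level :: "real ^ 'n \<Rightarrow> nat \<Rightarrow> bool" where
  "has_sparsity_level u l \<longleftrightarrow> card {j. u $ j \<noteq> 0} = l"

definition regularization_solution ::
  "(real ^ 'n \<Rightarrow> real) \<Rightarrow> real \<Rightarrow> real ^ 'n \<Rightarrow> bool" where
  "regularization_solution \<Psi> lam u \<longleftrightarrow> is_arg_min (\<lambda>v. \<Psi> v + lam * l1_norm v) (\<lambda>v. v \<in> UNIV) u"

end

theory Submission
  imports Defs
begin

text \<open>The objective is separable, so it is minimized coordinatewise. Each coordinate objective
  \<open>\<psi>\<^sub>j t + \<lambda> \<bar>t\<bar>\<close> is continuous and, since \<open>\<psi>\<^sub>j\<close> inherits a lower bound from nonnegativity of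
  the sum, coercive; so it has a minimizer. By convexity \<open>0\<close> is one exactly when
  \<open>\<lambda> \<ge> max (\<psi>\<^sub>j'\<^sub>-(0)) (-\<psi>\<^sub>j'\<^sub>+(0))\<close>. A sparse solution puts \<open>0\<close> wherever this inequality holds.\<close>

section \<open>One-sided derivatives of convex functions on the line\<close>

lemma convex_on_slope_mono:
  fixes f :: "real \<Rightarrow> real"
  assumes "convex_on UNIV f" "s < t" "s \<noteq> x" "t \<noteq> x"
  shows "(f s - f x) / (s - x) \<le> (f t - f x) / (t - x)"
proof -
  have swap: "(f x - f y) / (x - y) = (f y - f x) / (y - x)" for x y
    by (metis minus_diff_eq minus_divide_divide)
  note slope = convex_on_slope_le[OF assms(1) UNIV_I UNIV_I]
  \<comment> \<open>Three-point slope inequalities concern ordered triples, so the position of the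
    base point \<open>x\<close> decides which instance applies.\<close>
  consider "x < s" | "s < x" "x < t" | "t < x" using assms by linarith
  then show ?thesis
  proof cases
    case 1
    then show ?thesis using slope(1)[of x s t] assms swap[of x] by simp
  next
    case 2
    then show ?thesis using slope[of s x t] swap[of x t] by simp
  next
    case 3
    then show ?thesis using slope(2)[of s t x] assms by simp
  qed
qed

text \<open>\<open>Lim\<close> is meaningful only once a limit is known to exist. Slopes from
  \<open>x\<close> increase with \<open>t\<close>, so from the right they converge to their
  infimum.\<close>

lemma convex_on_tendsto_right_deriv:
  fixes f :: "real \<Rightarrow> real"
  assumes f: "convex_on UNIV f"
  shows "((\<lambda>t. (f t - f x) / (t - x)) \<longlongrightarrow> right_deriv f x) (at_right x)"
    and "\<And>t. x < t \<Longrightarrow> right_deriv f x \<le> (f t - f x) / (t - x)"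
proof -
  define q where "q t = (f t - f x) / (t - x)" for t
  define L where "L = Inf (q ` {x<..})"
  \<comment> \<open>The slope towards any point left of \<open>x\<close>, here \<open>x - 1\<close>,
    lies below all slopes to the right.\<close>
  have bdd: "bdd_below (q ` {x<..})"
    by (rule bdd_belowI[where m = "q (x - 1)"])
      (auto simp only: q_def image_iff greaterThan_iff intro!: convex_on_slope_mono[OF f])
  have le: "L \<le> q t" if "x < t" for t
    unfolding L_def using bdd that by (auto intro: cInf_lower)
  have lim: "(q \<longlongrightarrow> L) (at_right x)"
  proof (rule order_tendstoI)
    fix a assume "a < L"
    then show "\<forall>\<^sub>F t in at_right x. a < q t"
      unfolding eventually_at_right_field by (meson le less_le_trans gt_ex)
  next
    fix a assume "L < a"
    then obtain s where s: "x < s" "q s < a"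
      unfolding L_def using bdd by (auto simp: cInf_less_iff)
    \<comment> \<open>Monotonicity carries the bound at the single point \<open>s\<close> to all
      points between \<open>x\<close> and \<open>s\<close>.\<close>
    have "q t < a" if "x < t" "t < s" for t
      using convex_on_slope_mono[OF f that(2), of x] that s unfolding q_def by simp
    then show "\<forall>\<^sub>F t in at_right x. q t < a"
      using s by (auto simp: eventually_at_right_field)
  qed
  have "right_deriv f x = L"
    using tendsto_Lim[OF _ lim] unfolding right_deriv_def q_def by simp
  then show "((\<lambda>t. (f t - f x) / (t - x)) \<longlongrightarrow> right_deriv f x) (at_right x)"
    and "\<And>t. x < t \<Longrightarrow> right_deriv f x \<le> (f t - f x) / (t - x)"
    using lim le unfolding q_def by auto
qed

text \<open>Being both a lower bound and the limit of the right slopes, the right derivative admits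
  a limit-free description by lines below the graph.\<close>

lemma le_right_deriv_iff:
  fixes f :: "real \<Rightarrow> real"
  assumes "convex_on UNIV f"
  shows "c \<le> right_deriv f x \<longleftrightarrow> (\<forall>t>x. f x + c * (t - x) \<le> f t)"
proof -
  note lim = convex_on_tendsto_right_deriv[OF assms, where x = x]
  have eq: "f x + c * (t - x) \<le> f t \<longleftrightarrow> c \<le> (f t - f x) / (t - x)" if "x < t" for t
    using that by (simp add: pos_le_divide_eq algebra_simps)
  show ?thesis
  proof
    assume "c \<le> right_deriv f x"
    then show "\<forall>t>x. f x + c * (t - x) \<le> f t" using lim(2) eq by (meson order_trans)
  next
    assume "\<forall>t>x. f x + c * (t - x) \<le> f t"
    then have "\<forall>\<^sub>F t in at_right x. c \<le> (f t - f x) / (t - x)"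
      using eq by (auto simp: eventually_at_right_field intro: gt_ex)
    then show "c \<le> right_deriv f x"
      using tendsto_lowerbound[OF lim(1)] by simp
  qed
qed

text \<open>Reflection swaps the two sides and reverses the sign of slopes, so facts on right
  derivatives transfer to left ones.\<close>

lemma left_deriv_mirror:
  fixes f :: "real \<Rightarrow> real"
  assumes "convex_on UNIV (\<lambda>t. f (- t))"
  shows "left_deriv f x = - right_deriv (\<lambda>t. f (- t)) (- x)"
proof -
  have "((\<lambda>t. - ((f (- t) - f x) / (t + x))) \<longlongrightarrow> - right_deriv (\<lambda>t. f (- t)) (- x)) (at_right (- x))"
    using convex_on_tendsto_right_deriv(1)[OF assms, of "- x"] by (intro tendsto_minus) simp
  then have "((\<lambda>t. - ((f t - f x) / (- t + x))) \<longlongrightarrow> - right_deriv (\<lambda>t. f (- t)) (- x)) (at_left x)"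
    by (simp add: at_left_minus[of x] filterlim_filtermap add.commute)
  moreover have "- ((f t - f x) / (- t + x)) = (f t - f x) / (t - x)" for t
    by (metis add.commute minus_diff_eq minus_divide_right uminus_add_conv_diff)
  ultimately show ?thesis
    unfolding left_deriv_def by (intro tendsto_Lim) auto
qed

lemma left_deriv_le_iff:
  fixes f :: "real \<Rightarrow> real"
  assumes "convex_on UNIV f"
  shows "left_deriv f x \<le> c \<longleftrightarrow> (\<forall>t<x. f x + c * (t - x) \<le> f t)"
proof -
  have conv: "convex_on UNIV (\<lambda>t. f (- t))"
  proof (rule convex_onI)
    fix t y z :: real assume "0 < t" "t < 1"
    then show "f (- ((1 - t) *\<^sub>R y + t *\<^sub>R z)) \<le> (1 - t) * f (- y) + t * f (- z)"
      using convex_onD[OF assms, of t "- y" "- z"] by (simp add: algebra_simps)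
  qed simp
  have "left_deriv f x \<le> c \<longleftrightarrow> - c \<le> right_deriv (\<lambda>t. f (- t)) (- x)"
    unfolding left_deriv_mirror[OF conv] by linarith
  also have "\<dots> \<longleftrightarrow> (\<forall>t>- x. f x + - c * (t + x) \<le> f (- t))"
    unfolding le_right_deriv_iff[OF conv] by simp
  also have "\<dots> \<longleftrightarrow> (\<forall>t<x. f x + c * (t - x) \<le> f t)"
  proof safe
    fix t assume *: "\<forall>t>- x. f x + - c * (t + x) \<le> f (- t)" and "t < x"
    then show "f x + c * (t - x) \<le> f t" using *[rule_format, of "- t"] by (simp add: algebra_simps)
  next
    fix t assume *: "\<forall>t<x. f x + c * (t - x) \<le> f t" and "t > - x"
    then show "f x + - c * (t + x) \<le> f (- t)" using *[rule_format, of "- t"] by (simp add: algebra_simps)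
  qed
  finally show ?thesis .
qed

section \<open>The one-dimensional problem with absolute value penalty\<close>

lemma zero_minimizes_abs_penalty_iff:
  fixes f :: "real \<Rightarrow> real"
  assumes f: "convex_on UNIV f"
  shows "(\<forall>t. f 0 \<le> f t + c * \<bar>t\<bar>) \<longleftrightarrow> max (left_deriv f 0) (- right_deriv f 0) \<le> c"
proof -
  have "max (left_deriv f 0) (- right_deriv f 0) \<le> c \<longleftrightarrow>
      left_deriv f 0 \<le> c \<and> - c \<le> right_deriv f 0"
    by auto
  \<comment> \<open>The penalty is linear on each side of \<open>0\<close>, so minimality there
    means that the line of slope \<open>c\<close> on the left, and of slope \<open>- c\<close> on
    the right, stays below the graph.\<close>
  also have "\<dots> \<longleftrightarrow> (\<forall>t<0. f 0 \<le> f t + c * \<bar>t\<bar>) \<and> (\<forall>t>0. f 0 \<le> f t + c * \<bar>t\<bar>)"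
    unfolding left_deriv_le_iff[OF f] le_right_deriv_iff[OF f] by (simp add: algebra_simps)
  also have "\<dots> \<longleftrightarrow> (\<forall>t. f 0 \<le> f t + c * \<bar>t\<bar>)"
    by (metis abs_zero add.right_neutral mult_zero_right order_refl linorder_neqE)
  finally show ?thesis by simp
qed

lemma abs_penalty_minimizer_exists:
  fixes f :: "real \<Rightarrow> real"
  assumes cont: "continuous_on UNIV f" and bound: "\<And>t. b \<le> f t" and "0 < c"
  shows "\<exists>s. \<forall>t. f s + c * \<bar>s\<bar> \<le> f t + c * \<bar>t\<bar>"
proof -
  \<comment> \<open>Beyond this radius the penalty exceeds \<open>f 0 - b\<close>, so the objective
    exceeds its value at \<open>0\<close>. As \<open>0\<close> lies in the compact interval, the
    minimizer found there is global.\<close>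
  define R where "R = (f 0 - b) / c"
  have "0 \<le> R" using bound[of 0] \<open>0 < c\<close> by (simp add: R_def)
  have "\<exists>s\<in>{-R..R}. \<forall>t\<in>{-R..R}. f s + c * \<bar>s\<bar> \<le> f t + c * \<bar>t\<bar>"
    using \<open>0 \<le> R\<close>
    by (intro continuous_attains_inf continuous_intros continuous_on_subset[OF cont]) auto
  then obtain s where s: "\<And>t. \<bar>t\<bar> \<le> R \<Longrightarrow> f s + c * \<bar>s\<bar> \<le> f t + c * \<bar>t\<bar>"
    unfolding Bex_def Ball_def atLeastAtMost_iff abs_le_iff by (metis minus_le_iff)
  have "f s + c * \<bar>s\<bar> \<le> f t + c * \<bar>t\<bar>" if "R < \<bar>t\<bar>" for t
  proof -
    have "f 0 - b < c * \<bar>t\<bar>" using that \<open>0 < c\<close> by (simp add: R_def field_simps)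
    then show ?thesis using bound[of t] s[of 0] \<open>0 \<le> R\<close> by simp
  qed
  then show ?thesis using s by (meson not_le)
qed

section \<open>Separable sums and choice of indices\<close>

lemma sum_fun_upd_vec:
  fixes h :: "'n::finite \<Rightarrow> 'a \<Rightarrow> real"
  shows "(\<Sum>i\<in>UNIV. h i ((\<chi> i. if i = j then t else u $ i) $ i)) =
    (\<Sum>i\<in>UNIV. h i (u $ i)) - h j (u $ j) + h j t"
  by (simp add: sum.remove[of UNIV j])

text \<open>Varying one coordinate leaves the other summands fixed; conversely, coordinatewise
  inequalities add up.\<close>

lemma separable_minimizer_iff:
  fixes h :: "'n::finite \<Rightarrow> 'a \<Rightarrow> real"
  shows "(\<forall>v. (\<Sum>i\<in>UNIV. h i (u $ i)) \<le> (\<Sum>i\<in>UNIV. h i (v $ i))) \<longleftrightarrow>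
    (\<forall>j t. h j (u $ j) \<le> h j t)"
proof (intro iffI allI)
  fix j t assume "\<forall>v. (\<Sum>i\<in>UNIV. h i (u $ i)) \<le> (\<Sum>i\<in>UNIV. h i (v $ i))"
  then have "(\<Sum>i\<in>UNIV. h i (u $ i)) \<le>
      (\<Sum>i\<in>UNIV. h i ((\<chi> i. if i = j then t else u $ i) $ i))" by blast
  then show "h j (u $ j) \<le> h j t" unfolding sum_fun_upd_vec by simp
qed (auto intro: sum_mono)

text \<open>The condition asks for exactly \<open>l\<close> distinct indices, so a support with
  fewer elements is padded to size \<open>l\<close> before being enumerated.\<close>

lemma ex_superset_nat_image:
  fixes A :: "'n::finite set"
  assumes "card A \<le> l" "l \<le> CARD('n)"
  obtains k :: "nat \<Rightarrow> 'n" where "inj_on k {1..l}" "A \<subseteq> k ` {1..l}"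
proof -
  obtain S where S: "A \<subseteq> S" "card S = l"
    using exists_subset_between[of A l UNIV] assms by auto
  then obtain k where "bij_betw k {1..l} S"
    using ex_bij_betw_nat_finite_1[of S] by auto
  then show thesis using that S by (auto simp: bij_betw_def)
qed

text \<open>The two-sided limit of the difference quotients restricts to each side, and limits are
  unique.\<close>

lemma left_right_deriv_eq_deriv:
  assumes "f differentiable at x"
  shows "left_deriv f x = deriv f x" "right_deriv f x = deriv f x"
proof -
  have "(f has_real_derivative deriv f x) (at x)"
    using assms DERIV_deriv_iff_real_differentiable by blast
  then have "((\<lambda>t. (f t - f x) / (t - x)) \<longlongrightarrow> deriv f x) (at x)"
    by (simp add: has_field_derivative_iff)
  then have "((\<lambda>t. (f t - f x) / (t - x)) \<longlongrightarrow> deriv f x) (at_left x)"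
    "((\<lambda>t. (f t - f x) / (t - x)) \<longlongrightarrow> deriv f x) (at_right x)"
    by (auto simp: filterlim_at_split)
  then show "left_deriv f x = deriv f x" "right_deriv f x = deriv f x"
    unfolding left_deriv_def right_deriv_def by (auto intro: tendsto_Lim)
qed

theorem theorem3p2:
  fixes \<psi> :: "'n::finite \<Rightarrow> real \<Rightarrow> real"
    and \<Psi> :: "real ^ 'n \<Rightarrow> real"
    and lam :: real
    and l :: nat
  assumes convex: "\<And>j. convex_on UNIV (\<psi> j)"
    and nonneg: "\<And>u. 0 \<le> \<Psi> u"
    and separable: "\<And>u. \<Psi> u = (\<Sum>j\<in>UNIV. \<psi> j (u $ j))"
    and lambda_pos: "0 < lam"
    and l_le: "l \<le> CARD('n)"
  shows "((\<exists>u. regularization_solution \<Psi> lam u \<and> (\<exists>l'\<le>l. has_sparsity_level u l')) \<longleftrightarrow>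
          (\<exists>k :: nat \<Rightarrow> 'n. inj_on k {1..l} \<and>
             (\<forall>j \<in> UNIV - k ` {1..l}.
                lam \<ge> max (left_deriv (\<psi> j) 0) (- right_deriv (\<psi> j) 0)))) \<and>
         ((\<forall>j x. \<psi> j differentiable at x) \<longrightarrow>
          (\<forall>k :: nat \<Rightarrow> 'n. inj_on k {1..l} \<longrightarrow>
             ((\<forall>j \<in> UNIV - k ` {1..l}.
                 lam \<ge> max (left_deriv (\<psi> j) 0) (- right_deriv (\<psi> j) 0)) \<longleftrightarrow>
              (\<forall>j \<in> UNIV - k ` {1..l}. lam \<ge> \<bar>deriv (\<psi> j) 0\<bar>))))"
proof -
  define h where "h j t = \<psi> j t + lam * \<bar>t\<bar>" for j t
  have solution_iff: "regularization_solution \<Psi> lam u \<longleftrightarrow> (\<forall>j t. h j (u $ j) \<le> h j t)" for u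
    unfolding separable_minimizer_iff[symmetric]
    by (simp add: regularization_solution_def is_arg_min_linorder separable l1_norm_def h_def
        sum.distrib sum_distrib_left)
  have zero_iff: "(\<forall>t. h j 0 \<le> h j t) \<longleftrightarrow>
      lam \<ge> max (left_deriv (\<psi> j) 0) (- right_deriv (\<psi> j) 0)" for j
    using zero_minimizes_abs_penalty_iff[OF convex, of j lam] by (simp add: h_def)
  have "\<exists>s. \<forall>t. h j s \<le> h j t" for j
  proof -
    \<comment> \<open>The vector with \<open>t\<close> at \<open>j\<close> and \<open>0\<close>
      elsewhere has value \<open>\<Psi> 0 - \<psi> j 0 + \<psi> j t\<close>, which is
      nonnegative.\<close>
    have "\<psi> j 0 - \<Psi> 0 \<le> \<psi> j t" for t
      using nonneg[of "\<chi> i. if i = j then t else 0 $ i"]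
      unfolding separable sum_fun_upd_vec by simp
    then show ?thesis
      unfolding h_def
      using abs_penalty_minimizer_exists convex_on_continuous[OF open_UNIV convex] lambda_pos
      by blast
  qed
  then obtain s where s: "\<And>j t. h j (s j) \<le> h j t" by metis
  have "(\<exists>u. regularization_solution \<Psi> lam u \<and> card {j. u $ j \<noteq> 0} \<le> l) \<longleftrightarrow>
      (\<exists>k :: nat \<Rightarrow> 'n. inj_on k {1..l} \<and> (\<forall>j \<in> UNIV - k ` {1..l}. \<forall>t. h j 0 \<le> h j t))"
  proof safe
    fix u assume u: "regularization_solution \<Psi> lam u" "card {j. u $ j \<noteq> 0} \<le> l"
    obtain k :: "nat \<Rightarrow> 'n" where k: "inj_on k {1..l}" "{j. u $ j \<noteq> 0} \<subseteq> k ` {1..l}"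
      using ex_superset_nat_image[OF u(2) l_le] .
    have "h j 0 \<le> h j t" if "j \<in> UNIV - k ` {1..l}" for j t
    proof -
      have "u $ j = 0" using k that by auto
      then show ?thesis using u(1) unfolding solution_iff by metis
    qed
    then show "\<exists>k :: nat \<Rightarrow> 'n. inj_on k {1..l} \<and>
        (\<forall>j \<in> UNIV - k ` {1..l}. \<forall>t. h j 0 \<le> h j t)"
      using k by blast
  next
    fix k :: "nat \<Rightarrow> 'n"
    assume k: "inj_on k {1..l}" "\<forall>j \<in> UNIV - k ` {1..l}. \<forall>t. h j 0 \<le> h j t"
    \<comment> \<open>Chosen coordinates get any minimizer \<open>s j\<close>, which may itself be
      \<open>0\<close>; hence only a sparsity level of at most \<open>l\<close>.\<close>
    define u :: "real ^ 'n" where "u = (\<chi> j. if j \<in> k ` {1..l} then s j else 0)"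
    have "card {j. u $ j \<noteq> 0} \<le> card (k ` {1..l})"
      by (rule card_mono) (auto simp: u_def)
    then have "card {j. u $ j \<noteq> 0} \<le> l" using k by (simp add: card_image)
    moreover have "regularization_solution \<Psi> lam u"
      unfolding solution_iff using s k by (simp add: u_def)
    ultimately show "\<exists>u. regularization_solution \<Psi> lam u \<and> card {j. u $ j \<noteq> 0} \<le> l" by blast
  qed
  \<comment> \<open>Both one-sided derivatives equal some \<open>d\<close>, and the maximum of
    \<open>d\<close> and \<open>- d\<close> is its absolute value.\<close>
  moreover have "max (left_deriv (\<psi> j) 0) (- right_deriv (\<psi> j) 0) = \<bar>deriv (\<psi> j) 0\<bar>"
    if "\<forall>j x. \<psi> j differentiable at x" for j
    using that by (simp add: left_right_deriv_eq_deriv abs_real_def max_def)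
  ultimately show ?thesis
    by (simp add: zero_iff has_sparsity_level_def)
qed

end
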